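(* Let $n\ge 2$ be an integer, $E=\{1,2,\dots,n\}$, and let $Q=(q_{ij})_{i,j\in E}$ be a real matrix such that (1) $0<-q_{ii}<\infty$ for all $i\in E$; (2) $q_{ij}>0$ for all $i,j\in E$ with $i\ne j$; (3) $\sum_{j\in E}q_{ij}\le 0$ for all $i\in E$. Let $\beta(i)>0$, $1\le i\le n$, be real numbers. Then there exist real numbers $\alpha(i)>0$, $1\le i\le n$, such that $$\sum_{j\in E}q_{ij}\frac{\alpha(j)}{\alpha(i)}\beta(j)=\sum_{j\in E}q_{ji}\frac{\alpha(i)}{\alpha(j)}\beta(j)\qquad\text{for all } i\in E.$$
   Context: In the source, $Q$ is the $Q$-matrix of a continuous-time Markov chain with state space $E$ (not necessarily conservative and not necessarily symmetric); the only properties of $Q$ assumed are (1)–(3) stated in the claim. *)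

theory Defs
  imports "HOL-Analysis.Analysis"
begin

end

theory Submission
  imports Defs
begin

text \<open>
  After multiplying the \<open>i\<close>-th equation by \<open>\<beta> i\<close>, both sides involve only the weights
  \<open>b i j = \<beta> i * Q $ i $ j * \<beta> j\<close>, and the claim says that the diagonal similarity
  \<open>b i j * \<alpha> j / \<alpha> i\<close> has each row sum equal to the corresponding column sum. This is
  matrix balancing, and it has a variational solution: with \<open>\<alpha> i = exp (x i)\<close>, the difference
  of the \<open>i\<close>-th column sum and the \<open>i\<close>-th row sum is the partial derivative in direction \<open>i\<close>
  of the total sum
  \<open>F x = (\<Sum>i j. b i j * exp (x j - x i))\<close>, so any minimiser of \<open>F\<close> yields a suitable \<open>\<alpha>\<close>
  (lemma \<open>balance_energy_critical\<close>).

  A minimiser exists because \<open>F\<close> is invariant under adding a constant to all coordinates, and,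
  once a coordinate is normalised to \<open>0\<close>, it is large as soon as some other coordinate is:
  every off-diagonal weight is positive, so one of the two terms that link these coordinates
  is large while all others are nonnegative (lemma \<open>balance_energy_attains_min\<close>). For the
  latter the negative diagonal weights are replaced by \<open>0\<close>, which changes \<open>F\<close> only by a constant
  and both sides of each equation by the same amount.
\<close>

definition balance_energy :: "('n \<Rightarrow> 'n \<Rightarrow> real) \<Rightarrow> real ^ 'n \<Rightarrow> real"
  where "balance_energy b x = (\<Sum>i\<in>UNIV. \<Sum>j\<in>UNIV. b i j * exp (x $ j - x $ i))"

lemma balance_energy_shift:
  "balance_energy b (\<chi> i. x $ i - c) = balance_energy b x"
  by (simp add: balance_energy_def)

lemma balance_energy_ge_term:
  assumes "\<And>i j. b i j \<ge> 0"
  shows "b i j * exp (x $ j - x $ i) \<le> balance_energy b x"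
proof -
  have "b i j * exp (x $ j - x $ i) \<le> (\<Sum>j\<in>UNIV. b i j * exp (x $ j - x $ i))"
    by (rule member_le_sum) (auto simp: assms)
  also have "\<dots> \<le> balance_energy b x"
    unfolding balance_energy_def
    by (rule member_le_sum[where f = "\<lambda>i. \<Sum>j\<in>UNIV. b i j * exp (x $ j - x $ i)"])
       (auto simp: assms intro!: sum_nonneg)
  finally show ?thesis .
qed

text \<open>
  Minimise over a cube so large that a point with one coordinate \<open>0\<close> which lies outside of it
  has at least the energy of the origin; a shift brings every other point into this position.
\<close>

lemma balance_energy_attains_min:
  fixes b :: "'n::finite \<Rightarrow> 'n \<Rightarrow> real"
  assumes nonneg: "\<And>i j. b i j \<ge> 0"
    and pos: "\<And>i j. i \<noteq> j \<Longrightarrow> b i j > 0"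
  obtains x where "\<And>y. balance_energy b x \<le> balance_energy b y"
proof -
  define F where "F = balance_energy b"
  \<comment> \<open>Any nonnegative bound on the off-diagonal ratios \<open>F 0 / b i j\<close> would do as half the side
    length; the sum over all pairs, in which division by a zero diagonal weight gives \<open>0\<close>, is such a bound.\<close>
  define R where "R = (\<Sum>i\<in>UNIV. \<Sum>j\<in>UNIV. F 0 / b i j)"
  have F0: "F 0 \<ge> 0"
    unfolding F_def balance_energy_def by (intro sum_nonneg) (simp add: nonneg)
  have R0: "R \<ge> 0"
    unfolding R_def by (intro sum_nonneg) (simp add: nonneg F0)
  have R_large: "F 0 \<le> b i j * exp R" if "i \<noteq> j" for i j
  proof -
    have "F 0 / b i j \<le> (\<Sum>j\<in>UNIV. F 0 / b i j)"
      by (rule member_le_sum) (auto simp: nonneg F0)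
    also have "\<dots> \<le> R"
      unfolding R_def
      by (rule member_le_sum[where f = "\<lambda>i. \<Sum>j\<in>UNIV. F 0 / b i j"])
         (auto simp: nonneg F0 intro!: sum_nonneg)
    also have "\<dots> \<le> exp R"
      using exp_ge_add_one_self[of R] by linarith
    finally show ?thesis
      using pos[OF that] by (simp add: field_simps)
  qed
  define S :: "(real ^ 'n) set" where "S = cbox (\<chi> i. - R) (\<chi> i. R)"
  have S_iff: "x \<in> S \<longleftrightarrow> (\<forall>i. \<bar>x $ i\<bar> \<le> R)" for x
    unfolding S_def mem_box_cart by (auto simp: abs_le_iff minus_le_iff)
  have "0 \<in> S"
    using R0 by (simp add: S_iff)
  have "continuous_on S F"
    unfolding F_def balance_energy_def by (intro continuous_intros)
  moreover have "compact S"
    unfolding S_def by (rule compact_cbox)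
  ultimately obtain x where x: "\<And>y. y \<in> S \<Longrightarrow> F x \<le> F y"
    using continuous_attains_inf[of S F] \<open>0 \<in> S\<close> by blast
  have "F x \<le> F y" for y
  proof -
    fix k :: 'n
    define z where "z = (\<chi> i. y $ i - y $ k)"
    have Fz: "F z = F y"
      unfolding F_def z_def by (rule balance_energy_shift)
    have zk: "z $ k = 0"
      by (simp add: z_def)
    show ?thesis
    proof (cases "z \<in> S")
      case True
      then show ?thesis
        using x Fz by metis
    next
      case False
      then obtain i where i: "\<bar>z $ i\<bar> > R"
        unfolding S_iff by (auto simp: not_le)
      with R0 zk have ik: "i \<noteq> k"
        by auto
      have "\<exists>p q. p \<noteq> q \<and> R \<le> z $ q - z $ p"
      proof (cases "z $ i \<ge> 0")
        case True
        with i zk ik show ?thesis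
          by (intro exI[of _ k] exI[of _ i]) auto
      next
        case False
        with i zk ik show ?thesis
          by (intro exI[of _ i] exI[of _ k]) auto
      qed
      then obtain p q where pq: "p \<noteq> q" "R \<le> z $ q - z $ p"
        by blast
      have "F x \<le> F 0"
        using x \<open>0 \<in> S\<close> by blast
      also have "\<dots> \<le> b p q * exp R"
        by (rule R_large[OF pq(1)])
      also have "\<dots> \<le> b p q * exp (z $ q - z $ p)"
        using pq(2) nonneg by (intro mult_left_mono) auto
      also have "\<dots> \<le> F z"
        unfolding F_def by (rule balance_energy_ge_term[OF nonneg])
      finally show ?thesis
        by (simp add: Fz)
    qed
  qed
  then show thesis
    using that unfolding F_def by blast
qed

text \<open>
  Fermat's rule along the \<open>i\<close>-th axis: the only terms that vary are those of the \<open>i\<close>-th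
  column, which enter the derivative with a plus sign, and those of the \<open>i\<close>-th row, which enter
  with a minus sign.
\<close>

lemma balance_energy_critical:
  fixes b :: "'n::finite \<Rightarrow> 'n \<Rightarrow> real"
  assumes min: "\<And>y. balance_energy b x \<le> balance_energy b y"
  shows "(\<Sum>j\<in>UNIV. b i j * exp (x $ j - x $ i)) = (\<Sum>j\<in>UNIV. b j i * exp (x $ i - x $ j))"
proof -
  define d :: "'n \<Rightarrow> real" where "d k = (if k = i then 1 else 0)" for k
  define g where "g t = balance_energy b (\<chi> k. x $ k + t * d k)" for t
  define D where "D = (\<Sum>j\<in>UNIV. \<Sum>k\<in>UNIV. b j k * (exp (x $ k - x $ j) * (d k - d j)))"
  have "(g has_real_derivative D) (at 0)"
    unfolding g_def D_def balance_energy_def vec_lambda_beta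
    by (auto intro!: derivative_eq_intros sum.cong)
  moreover have "g 0 \<le> g t" for t
    using min by (simp add: g_def)
  ultimately have "D = 0"
    by (intro DERIV_local_min[of g D 0 1]) auto
  moreover have "D = (\<Sum>j\<in>UNIV. \<Sum>k\<in>UNIV. b j k * exp (x $ k - x $ j) * d k)
      - (\<Sum>j\<in>UNIV. (\<Sum>k\<in>UNIV. b j k * exp (x $ k - x $ j)) * d j)"
    unfolding D_def by (simp add: algebra_simps sum_subtractf sum_distrib_left)
  moreover have "(\<Sum>j\<in>UNIV. \<Sum>k\<in>UNIV. b j k * exp (x $ k - x $ j) * d k)
      = (\<Sum>j\<in>UNIV. b j i * exp (x $ i - x $ j))"
    by (simp add: d_def if_distrib[of "\<lambda>u. _ * u"] cong: if_cong)
  moreover have "(\<Sum>j\<in>UNIV. (\<Sum>k\<in>UNIV. b j k * exp (x $ k - x $ j)) * d j)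
      = (\<Sum>k\<in>UNIV. b i k * exp (x $ k - x $ i))"
    by (simp add: d_def if_distrib[of "\<lambda>u. _ * u"] cong: if_cong)
  ultimately show ?thesis
    by simp
qed

lemma matrix_balancing:
  fixes b :: "'n::finite \<Rightarrow> 'n \<Rightarrow> real"
  assumes pos: "\<And>i j. i \<noteq> j \<Longrightarrow> b i j > 0"
  obtains \<alpha> :: "'n \<Rightarrow> real" where "\<And>i. \<alpha> i > 0"
    and "\<And>i. (\<Sum>j\<in>UNIV. b i j * (\<alpha> j / \<alpha> i)) = (\<Sum>j\<in>UNIV. b j i * (\<alpha> i / \<alpha> j))"
proof -
  define c where "c i j = (if i = j then 0 else b i j)" for i j
  obtain x where min: "\<And>y. balance_energy c x \<le> balance_energy c y"
    by (rule balance_energy_attains_min[of c]) (auto simp: c_def pos less_imp_le)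
  define \<alpha> where "\<alpha> i = exp (x $ i)" for i
  have "(\<Sum>j\<in>UNIV. b i j * (\<alpha> j / \<alpha> i)) = (\<Sum>j\<in>UNIV. b j i * (\<alpha> i / \<alpha> j))" for i
  proof -
    have c_balanced: "(\<Sum>j\<in>UNIV. c i j * (\<alpha> j / \<alpha> i)) = (\<Sum>j\<in>UNIV. c j i * (\<alpha> i / \<alpha> j))"
      using balance_energy_critical[OF min, of i] by (simp add: \<alpha>_def exp_diff)
    have "(\<Sum>j\<in>UNIV. b i j * (\<alpha> j / \<alpha> i)) = b i i + (\<Sum>j\<in>UNIV. c i j * (\<alpha> j / \<alpha> i))"
      by (subst (1 2) sum.remove[of _ i]) (auto simp: c_def \<alpha>_def intro!: sum.cong)
    moreover have "(\<Sum>j\<in>UNIV. b j i * (\<alpha> i / \<alpha> j)) = b i i + (\<Sum>j\<in>UNIV. c j i * (\<alpha> i / \<alpha> j))"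
      by (subst (1 2) sum.remove[of _ i]) (auto simp: c_def \<alpha>_def intro!: sum.cong)
    ultimately show ?thesis
      using c_balanced by simp
  qed
  then show thesis
    using that[of \<alpha>] by (simp add: \<alpha>_def)
qed

theorem theorem1p2:
  fixes Q :: "real ^ 'n ^ 'n" and \<beta> :: "'n \<Rightarrow> real"
  assumes "CARD('n) \<ge> 2"
    and "\<And>i. 0 < - (Q $ i $ i)"
    and "\<And>i j. i \<noteq> j \<Longrightarrow> Q $ i $ j > 0"
    and "\<And>i. (\<Sum>j\<in>UNIV. Q $ i $ j) \<le> 0"
    and "\<And>i. \<beta> i > 0"
  shows "\<exists>\<alpha> :: 'n \<Rightarrow> real. (\<forall>i. \<alpha> i > 0) \<and>
    (\<forall>i. (\<Sum>j\<in>UNIV. Q $ i $ j * (\<alpha> j / \<alpha> i) * \<beta> j)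
        = (\<Sum>j\<in>UNIV. Q $ j $ i * (\<alpha> i / \<alpha> j) * \<beta> j))"
proof -
  obtain \<alpha> :: "'n \<Rightarrow> real" where \<alpha>: "\<And>i. \<alpha> i > 0"
    and bal: "\<And>i. (\<Sum>j\<in>UNIV. \<beta> i * Q $ i $ j * \<beta> j * (\<alpha> j / \<alpha> i))
      = (\<Sum>j\<in>UNIV. \<beta> j * Q $ j $ i * \<beta> i * (\<alpha> i / \<alpha> j))"
    using matrix_balancing[of "\<lambda>i j. \<beta> i * Q $ i $ j * \<beta> j"] assms(3,5) by auto
  have "(\<Sum>j\<in>UNIV. Q $ i $ j * (\<alpha> j / \<alpha> i) * \<beta> j)
      = (\<Sum>j\<in>UNIV. Q $ j $ i * (\<alpha> i / \<alpha> j) * \<beta> j)" for i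
  proof -
    have "\<beta> i * (\<Sum>j\<in>UNIV. Q $ i $ j * (\<alpha> j / \<alpha> i) * \<beta> j)
        = \<beta> i * (\<Sum>j\<in>UNIV. Q $ j $ i * (\<alpha> i / \<alpha> j) * \<beta> j)"
      using bal[of i] by (simp add: sum_distrib_left mult_ac)
    then show ?thesis
      using assms(5)[of i] by simp
  qed
  with \<alpha> show ?thesis
    by blast
qed

end
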